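(* Let $\mathcal{H}$ be a Hilbert space, let $\mathbb{D}\subseteq B(\mathcal{H})$ be a masa, and suppose $\mathcal{U}\subseteq B(\mathcal{H})$ is strongly reflexive and a unital $\mathbb{D}$-bimodule. Then $\mathcal{U}$ has the trivial intersection property.
   Context: All subspaces are assumed norm-closed; a subspace of $B(\mathcal{H})$ is unital if it contains the identity operator. A masa is an abelian self-adjoint subalgebra of $B(\mathcal{H})$ not properly contained in another abelian self-adjoint subalgebra of $B(\mathcal{H})$. A $\mathbb{D}$-bimodule is a subspace $\mathcal{U}$ with $\mathbb{D}\,\mathcal{U}\,\mathbb{D}\subseteq\mathcal{U}$. For a set $\mathscr{R}\subseteq B(\mathcal{H})$, its reflexive hull is $\mathrm{Ref}(\mathscr{R})=\{T\in B(\mathcal{H}): Tx\in\overline{[\mathscr{R}x]}\text{ for all }x\in\mathcal{H}\}$, where $[\,\cdot\,]$ denotes linear span and $\mathscr{R}x=\{Rx:R\in\mathscr{R}\}$. A subspace $\mathcal{U}\subseteq B(\mathcal{H})$ is strongly reflexive if there exists a set $\mathscr{R}$ of rank one operators with $\mathcal{U}=\mathrm{Ref}(\mathscr{R})$. $C^*(\mathcal{U})$ is the $C^*$-subalgebra of $B(\mathcal{H})$ generated by $\mathcal{U}$. A closed subspace $\mathcal{U}\subseteq B(\mathcal{H})$ has the trivial intersection property if for every closed two-sided ideal $J$ of $C^*(\mathcal{U})$, $\mathcal{U}\cap J=\{0\}$ implies $J=\{0\}$. *)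

theory Defs
  imports "HOL-Analysis.Analysis"
begin

section \<open>Complex Hilbert spaces\<close>

class complex_vector = real_vector +
  fixes scaleC :: "complex \<Rightarrow> 'a \<Rightarrow> 'a" (infixr "*\<^sub>C" 75)
  assumes scaleC_add_right: "a *\<^sub>C (x + y) = a *\<^sub>C x + a *\<^sub>C y"
    and scaleC_add_left: "(a + b) *\<^sub>C x = a *\<^sub>C x + b *\<^sub>C x"
    and scaleC_scaleC: "a *\<^sub>C b *\<^sub>C x = (a * b) *\<^sub>C x"
    and scaleR_scaleC: "r *\<^sub>R x = complex_of_real r *\<^sub>C x"

global_interpretation complex_vector:
  vector_space "scaleC :: complex \<Rightarrow> 'a \<Rightarrow> 'a::complex_vector"
proof
  show "1 *\<^sub>C x = x" for x :: 'a
    using scaleR_scaleC[of 1 x] by simp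
qed (simp_all add: scaleC_add_right scaleC_add_left scaleC_scaleC)

class complex_normed_vector = complex_vector + real_normed_vector +
  assumes norm_scaleC: "norm (a *\<^sub>C x) = cmod a * norm x"

text \<open>
  The real inner product inherited from \<^class>\<open>real_inner\<close> is the real part of the complex one,
  so that norm and topology are those of the complex inner product. The latter is conjugate-linear
  in its first argument.
\<close>

class complex_inner = complex_vector + real_inner +
  fixes cinner :: "'a \<Rightarrow> 'a \<Rightarrow> complex"
  assumes cinner_commute: "cinner x y = cnj (cinner y x)"
    and cinner_add_left: "cinner (x + y) z = cinner x z + cinner y z"
    and cinner_scaleC_left: "cinner (a *\<^sub>C x) y = cnj a * cinner x y"
    and inner_eq_Re_cinner: "inner x y = Re (cinner x y)"
begin

lemma cinner_scaleC_right: "cinner x (a *\<^sub>C y) = a * cinner x y"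
  by (metis cinner_commute cinner_scaleC_left complex_cnj_cnj complex_cnj_mult)

subclass complex_normed_vector
proof
  fix a x
  have "inner (a *\<^sub>C x) (a *\<^sub>C x) = Re ((cnj a * a) * cinner x x)"
    unfolding inner_eq_Re_cinner cinner_scaleC_left cinner_scaleC_right
    by (simp only: mult.assoc mult.left_commute)
  also have "cnj a * a = complex_of_real ((cmod a)\<^sup>2)"
    by (metis complex_norm_square mult.commute of_real_power)
  finally have "inner (a *\<^sub>C x) (a *\<^sub>C x) = (cmod a)\<^sup>2 * inner x x"
    by (simp add: inner_eq_Re_cinner)
  then show "norm (a *\<^sub>C x) = cmod a * norm x"
    by (simp add: norm_eq_sqrt_inner real_sqrt_mult)
qed

end

class chilbert_space = complex_inner + complete_space

section \<open>Bounded operators\<close>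

lemma bounded_linear_scaleC: "bounded_linear (\<lambda>x::'a::complex_normed_vector. a *\<^sub>C x)"
proof (rule bounded_linear_intro)
  show "a *\<^sub>C (r *\<^sub>R x) = r *\<^sub>R (a *\<^sub>C x)" for r and x :: 'a
    by (simp add: scaleR_scaleC scaleC_scaleC mult.commute)
  show "norm (a *\<^sub>C x) \<le> norm x * cmod a" for x :: 'a
    by (simp add: norm_scaleC mult.commute)
qed (rule scaleC_add_right)

instantiation blinfun :: (real_normed_vector, complex_normed_vector) complex_normed_vector
begin

lift_definition scaleC_blinfun :: "complex \<Rightarrow> ('a \<Rightarrow>\<^sub>L 'b) \<Rightarrow> ('a \<Rightarrow>\<^sub>L 'b)"
  is "\<lambda>a T x. a *\<^sub>C T x"
  using bounded_linear_compose[OF bounded_linear_scaleC] by blast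

instance
proof
  fix a b :: complex and r :: real and S T :: "'a \<Rightarrow>\<^sub>L 'b"
  show "a *\<^sub>C (S + T) = a *\<^sub>C S + a *\<^sub>C T"
    by transfer (simp add: scaleC_add_right)
  show "(a + b) *\<^sub>C T = a *\<^sub>C T + b *\<^sub>C T"
    by transfer (simp add: scaleC_add_left)
  show "a *\<^sub>C b *\<^sub>C T = (a * b) *\<^sub>C T"
    by transfer (simp add: scaleC_scaleC)
  show "r *\<^sub>R T = complex_of_real r *\<^sub>C T"
    by transfer (simp add: scaleR_scaleC)
  have le: "norm (c *\<^sub>C R) \<le> cmod c * norm R" for c and R :: "'a \<Rightarrow>\<^sub>L 'b"
  proof (rule norm_blinfun_bound)
    show "norm (blinfun_apply (c *\<^sub>C R) x) \<le> cmod c * norm R * norm x" for x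
      using mult_left_mono[OF norm_blinfun[of R x], of "cmod c"]
      by (simp add: scaleC_blinfun.rep_eq norm_scaleC mult.assoc)
  qed simp
  have ge: "cmod a * norm T \<le> norm (a *\<^sub>C T)"
  proof (cases "a = 0")
    case False
    have "inverse a *\<^sub>C a *\<^sub>C T = T"
      by (rule blinfun_eqI) (simp add: False scaleC_blinfun.rep_eq)
    then have "norm T \<le> cmod (inverse a) * norm (a *\<^sub>C T)"
      using le[of "inverse a" "a *\<^sub>C T"] by simp
    then show ?thesis
      using False by (simp add: norm_divide field_simps)
  qed simp
  show "norm (a *\<^sub>C T) = cmod a * norm T"
    using le ge by (rule antisym)
qed

end

text \<open>
  Elements of \<^typ>\<open>'a \<Rightarrow>\<^sub>L 'a\<close> are only real-linear; \<open>B(H)\<close> consists of the complex-linear ones.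
\<close>

definition bounded_ops :: "('h::chilbert_space \<Rightarrow>\<^sub>L 'h) set" where
  "bounded_ops = {T. \<forall>a x. blinfun_apply T (a *\<^sub>C x) = a *\<^sub>C blinfun_apply T x}"

text \<open>The adjoint exists and is unique for every \<open>T \<in> B(H)\<close>, by the Riesz representation theorem.\<close>

definition adj :: "('h::chilbert_space \<Rightarrow>\<^sub>L 'h) \<Rightarrow> ('h \<Rightarrow>\<^sub>L 'h)" where
  "adj T = (THE S. S \<in> bounded_ops \<and> (\<forall>x y. cinner (T x) y = cinner x (S y)))"

definition rank_one :: "('h::chilbert_space \<Rightarrow>\<^sub>L 'h) \<Rightarrow> bool" where
  "rank_one T \<longleftrightarrow> T \<in> bounded_ops \<and> complex_vector.dim (range (blinfun_apply T)) = 1"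

section \<open>Operator spaces and algebras\<close>

definition operator_space :: "('h::chilbert_space \<Rightarrow>\<^sub>L 'h) set \<Rightarrow> bool" where
  "operator_space U \<longleftrightarrow> U \<subseteq> bounded_ops \<and> complex_vector.subspace U \<and> closed U"

definition unital :: "('h::chilbert_space \<Rightarrow>\<^sub>L 'h) set \<Rightarrow> bool" where
  "unital U \<longleftrightarrow> id_blinfun \<in> U"

definition sa_subalgebra :: "('h::chilbert_space \<Rightarrow>\<^sub>L 'h) set \<Rightarrow> bool" where
  "sa_subalgebra A \<longleftrightarrow> operator_space A \<and>
     (\<forall>S\<in>A. \<forall>T\<in>A. S o\<^sub>L T \<in> A) \<and> (\<forall>T\<in>A. adj T \<in> A)"

definition abelian :: "('h::chilbert_space \<Rightarrow>\<^sub>L 'h) set \<Rightarrow> bool" where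
  "abelian A \<longleftrightarrow> (\<forall>S\<in>A. \<forall>T\<in>A. S o\<^sub>L T = T o\<^sub>L S)"

definition masa :: "('h::chilbert_space \<Rightarrow>\<^sub>L 'h) set \<Rightarrow> bool" where
  "masa D \<longleftrightarrow> sa_subalgebra D \<and> abelian D \<and>
     \<not> (\<exists>A. sa_subalgebra A \<and> abelian A \<and> D \<subset> A)"

definition bimodule :: "('h::chilbert_space \<Rightarrow>\<^sub>L 'h) set \<Rightarrow> ('h \<Rightarrow>\<^sub>L 'h) set \<Rightarrow> bool" where
  "bimodule D U \<longleftrightarrow> operator_space U \<and> (\<forall>A\<in>D. \<forall>T\<in>U. \<forall>B\<in>D. A o\<^sub>L T o\<^sub>L B \<in> U)"

definition reflexive_hull :: "('h::chilbert_space \<Rightarrow>\<^sub>L 'h) set \<Rightarrow> ('h \<Rightarrow>\<^sub>L 'h) set" where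
  "reflexive_hull \<R> =
     {T \<in> bounded_ops. \<forall>x. T x \<in> closure (complex_vector.span ((\<lambda>R. blinfun_apply R x) ` \<R>))}"

definition strongly_reflexive :: "('h::chilbert_space \<Rightarrow>\<^sub>L 'h) set \<Rightarrow> bool" where
  "strongly_reflexive U \<longleftrightarrow> operator_space U \<and>
     (\<exists>\<R>. (\<forall>R\<in>\<R>. rank_one R) \<and> U = reflexive_hull \<R>)"

definition cstar_generated :: "('h::chilbert_space \<Rightarrow>\<^sub>L 'h) set \<Rightarrow> ('h \<Rightarrow>\<^sub>L 'h) set" where
  "cstar_generated U = \<Inter>{A. sa_subalgebra A \<and> U \<subseteq> A}"

definition closed_ideal :: "('h::chilbert_space \<Rightarrow>\<^sub>L 'h) set \<Rightarrow> ('h \<Rightarrow>\<^sub>L 'h) set \<Rightarrow> bool" where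
  "closed_ideal J A \<longleftrightarrow> operator_space J \<and> J \<subseteq> A \<and>
     (\<forall>S\<in>A. \<forall>T\<in>J. S o\<^sub>L T \<in> J \<and> T o\<^sub>L S \<in> J)"

definition trivial_intersection_property :: "('h::chilbert_space \<Rightarrow>\<^sub>L 'h) set \<Rightarrow> bool" where
  "trivial_intersection_property U \<longleftrightarrow>
     (\<forall>J. closed_ideal J (cstar_generated U) \<longrightarrow> U \<inter> J = {0} \<longrightarrow> J = {0})"

end

theory Submission
  imports Defs
begin

text \<open>
  Let \<open>U = Ref \<R>\<close> with \<open>\<R>\<close> a set of rank one operators, so that \<open>\<R> \<subseteq> U\<close>, and let \<open>J\<close> be an ideal
  of \<open>C\<^sup>*(U)\<close> containing some \<open>T \<noteq> 0\<close>. Since \<open>1 \<in> Ref \<R>\<close>, no nonzero vector is annihilated by all of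
  \<open>\<R>\<close>; applied to a nonzero vector of the form \<open>T z\<close>, this gives \<open>R \<in> \<R>\<close> with \<open>P = R T \<noteq> 0\<close>
  (\<open>unital_hull_separates\<close>).

  The point is that \<open>R\<close> can be recovered from \<open>P\<close> inside the ideal. Both \<open>P\<close> and \<open>R\<close> have range in
  the line spanned by a single vector \<open>y\<close>, so \<open>P P\<^sup>*\<close> acts on this line as multiplication by a
  scalar \<open>c\<close>, and \<open>P P\<^sup>* R = c R\<close>. Here \<open>c \<noteq> 0\<close>, because \<open>P P\<^sup>* y = 0\<close> would give \<open>P\<^sup>* y = 0\<close> and
  make the range of \<open>P\<close> orthogonal to \<open>y\<close> (\<open>rank_one_recovery\<close>). Since \<open>P \<in> J\<close>, and \<open>P\<^sup>*\<close> and \<open>R\<close>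
  lie in \<open>C\<^sup>*(U)\<close>, it follows that \<open>R \<in> J\<close>. Thus \<open>R\<close> is a nonzero element of \<open>U \<inter> J\<close>.

  The remaining work is to see that \<^const>\<open>adj\<close> really is the Hilbert space adjoint, which rests on
  the Riesz representation theorem (\<open>riesz_representation\<close>).
\<close>

section \<open>Riesz representation and adjoints\<close>

text \<open>
  The representing vector is the minimiser of the energy \<open>Q x = \<parallel>x\<parallel>\<^sup>2 - 2 f x\<close>. The parallelogram law
  makes minimising sequences Cauchy. At a minimiser \<open>w\<close>, the derivative of \<open>Q\<close> in the direction \<open>v\<close>,
  which is twice \<open>\<langle>v, w\<rangle> - f v\<close>, must vanish.
\<close>

lemma riesz_representation:
  fixes f :: "'a::{real_inner, complete_space} \<Rightarrow> real"
  assumes "bounded_linear f"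
  shows "\<exists>w. \<forall>x. f x = inner x w"
proof -
  interpret f: bounded_linear f by fact
  obtain K where K: "\<And>x. norm (f x) \<le> norm x * K"
    using f.bounded by blast
  define Q where "Q x = (norm x)\<^sup>2 - 2 * f x" for x
  define m where "m = Inf (range Q)"
  have "- K\<^sup>2 \<le> Q x" for x
  proof -
    have "f x \<le> norm x * K"
      using K[of x] by simp
    moreover have "0 \<le> (norm x - K)\<^sup>2"
      by simp
    ultimately show ?thesis
      unfolding Q_def power2_diff by linarith
  qed
  then have bdd: "bdd_below (range Q)"
    by (auto intro!: bdd_belowI)
  have m_le: "m \<le> Q x" for x
    unfolding m_def by (rule cInf_lower[OF _ bdd]) simp
  have "\<exists>x. Q x < m + 1 / real (Suc n)" for n
    using cInf_lessD[of "range Q" "m + 1 / real (Suc n)"] unfolding m_def by auto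
  then obtain X where X: "\<And>n. Q (X n) < m + 1 / real (Suc n)"
    by metis
  have par: "(norm (x - y))\<^sup>2 \<le> 2 * (Q x - m) + 2 * (Q y - m)" for x y
  proof -
    define h where "h = (1/2) *\<^sub>R (x + y)"
    have "(norm (x - y))\<^sup>2 = 2 * Q x + 2 * Q y - 4 * Q h"
      by (simp add: Q_def h_def power2_norm_eq_inner inner_simps f.add f.scaleR inner_commute
          algebra_simps)
    also have "\<dots> \<le> 2 * Q x + 2 * Q y - 4 * m"
      using m_le[of h] by simp
    finally show ?thesis
      by simp
  qed
  have "Cauchy X"
  proof (rule metric_CauchyI)
    fix e :: real
    assume "e > 0"
    then obtain N where N: "1 / real (Suc N) < e\<^sup>2 / 4"
      using nat_approx_posE[of "e\<^sup>2 / 4"] by auto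
    have near: "Q (X n) - m < e\<^sup>2 / 4" if "n \<ge> N" for n
    proof -
      have "1 / real (Suc n) \<le> 1 / real (Suc N)"
        using that by (simp add: frac_le)
      then show ?thesis
        using X[of n] N by linarith
    qed
    show "\<exists>N. \<forall>k\<ge>N. \<forall>n\<ge>N. dist (X k) (X n) < e"
    proof (intro exI[of _ N] allI impI)
      fix k n
      assume "k \<ge> N" and "n \<ge> N"
      have "(norm (X k - X n))\<^sup>2 \<le> 2 * (Q (X k) - m) + 2 * (Q (X n) - m)"
        by (rule par)
      also have "\<dots> < e\<^sup>2"
        using near[OF \<open>k \<ge> N\<close>] near[OF \<open>n \<ge> N\<close>] by argo
      finally show "dist (X k) (X n) < e"
        using \<open>e > 0\<close> by (simp add: dist_norm power_less_imp_less_base)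
    qed
  qed
  then obtain w where w: "X \<longlonglongrightarrow> w"
    using Cauchy_convergent convergent_def by blast
  have "(\<lambda>n. Q (X n)) \<longlonglongrightarrow> Q w"
    unfolding Q_def by (intro tendsto_intros f.tendsto w)
  moreover have "(\<lambda>n. m + 1 / real (Suc n)) \<longlonglongrightarrow> m + 0"
    by (intro tendsto_add tendsto_const LIMSEQ_Suc[OF lim_1_over_n])
  ultimately have "Q w \<le> m + 0"
    by (rule LIMSEQ_le) (use X less_imp_le in blast)
  then have min: "Q w \<le> Q x" for x
    using m_le[of x] by simp
  have "f v = inner v w" for v
  proof (cases "v = 0")
    case False
    define d where "d = inner v w - f v"
    \<comment> \<open>The step that minimises \<open>Q\<close> along the line through \<open>w\<close> in the direction \<open>v\<close>.\<close>
    define s where "s = - d / (norm v)\<^sup>2"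
    have "Q (w + s *\<^sub>R v) = Q w + 2 * s * d + s\<^sup>2 * (norm v)\<^sup>2"
      by (simp add: Q_def d_def power2_norm_eq_inner inner_simps f.add f.scaleR inner_commute
          algebra_simps power2_eq_square[of s])
    also have "\<dots> = Q w - d\<^sup>2 / (norm v)\<^sup>2"
      using False by (simp add: s_def field_simps power2_eq_square)
    finally have "d\<^sup>2 / (norm v)\<^sup>2 \<le> 0"
      using min[of "w + s *\<^sub>R v"] by linarith
    then have "d = 0"
      using False by (simp add: divide_le_0_iff)
    then show ?thesis
      by (simp add: d_def)
  qed (simp add: f.zero)
  then show ?thesis
    by blast
qed

lemma real_adjoint_exists:
  fixes T :: "'a::{real_inner, complete_space} \<Rightarrow>\<^sub>L 'a"
  shows "\<exists>S :: 'a \<Rightarrow>\<^sub>L 'a. \<forall>x y. inner (T x) y = inner x (S y)"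
proof -
  have "\<exists>w. \<forall>x. inner (T x) y = inner x w" for y
    by (intro riesz_representation bounded_linear_intros)
  then obtain s where s: "\<And>x y. inner (T x) y = inner x (s y)"
    by metis
  have "bounded_linear s"
  proof (rule bounded_linear_intro[where K = "norm T"])
    show "s (x + y) = s x + s y" for x y
      by (rule vector_eq_ldot[THEN iffD1]) (simp add: inner_simps flip: s)
    show "s (r *\<^sub>R x) = r *\<^sub>R s x" for r x
      by (rule vector_eq_ldot[THEN iffD1]) (simp add: inner_simps flip: s)
    show "norm (s x) \<le> norm x * norm T" for x
    proof (cases "s x = 0")
      case False
      have "norm (s x) * norm (s x) = inner (T (s x)) x"
        by (simp add: s flip: power2_norm_eq_inner power2_eq_square)
      also have "\<dots> \<le> norm (T (s x)) * norm x"
        by (rule norm_cauchy_schwarz)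
      also have "\<dots> \<le> norm T * norm (s x) * norm x"
        by (intro mult_right_mono norm_blinfun norm_ge_zero)
      finally show ?thesis
        using False by (simp add: mult.commute mult.left_commute)
    qed simp
  qed
  then show ?thesis
    using s by (intro exI[of _ "Blinfun s"]) (simp add: bounded_linear_Blinfun_apply)
qed

lemma cinner_eqI:
  fixes u v :: "'a::complex_inner"
  assumes "\<And>x. cinner x u = cinner x v"
  shows "u = v"
  by (rule vector_eq_ldot[THEN iffD1]) (simp add: assms inner_eq_Re_cinner)

lemma cinner_self_eq_zeroD: "cinner x x = 0 \<Longrightarrow> x = 0"
  by (metis inner_eq_Re_cinner inner_eq_zero_iff zero_complex.sel(1))

text \<open>
  The imaginary part of \<open>cinner\<close> is its real part with the first argument multiplied by \<open>\<i>\<close>, so for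
  a complex-linear operator the adjoint with respect to the real inner product is already the
  adjoint with respect to the complex one.
\<close>

lemma adjoint_exists:
  fixes T :: "'h::chilbert_space \<Rightarrow>\<^sub>L 'h"
  assumes "T \<in> bounded_ops"
  shows "\<exists>S\<in>bounded_ops. \<forall>x y. cinner (T x) y = cinner x (S y)"
proof -
  obtain S :: "'h \<Rightarrow>\<^sub>L 'h" where S: "\<And>x y. inner (T x) y = inner x (S y)"
    using real_adjoint_exists by blast
  have Im_eq: "Im (cinner x y) = inner (\<i> *\<^sub>C x) y" for x y :: 'h
    by (simp add: inner_eq_Re_cinner cinner_scaleC_left)
  have adjoint: "cinner (T x) y = cinner x (S y)" for x y
  proof (rule complex_eqI)
    show "Re (cinner (T x) y) = Re (cinner x (S y))"
      using S[of x y] by (simp add: inner_eq_Re_cinner)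
    have "\<i> *\<^sub>C T x = T (\<i> *\<^sub>C x)"
      using assms by (simp add: bounded_ops_def)
    then show "Im (cinner (T x) y) = Im (cinner x (S y))"
      by (simp add: Im_eq S)
  qed
  have "S (a *\<^sub>C y) = a *\<^sub>C S y" for a y
    by (rule cinner_eqI) (simp add: cinner_scaleC_right flip: adjoint)
  then have "S \<in> bounded_ops"
    by (simp add: bounded_ops_def)
  with adjoint show ?thesis
    by blast
qed

lemma cinner_adj:
  assumes "T \<in> bounded_ops"
  shows "cinner (T x) y = cinner x (adj T y)"
proof -
  have "\<exists>!S. S \<in> bounded_ops \<and> (\<forall>x y. cinner (T x) y = cinner x (S y))"
  proof (rule ex_ex1I)
    show "\<exists>S. S \<in> bounded_ops \<and> (\<forall>x y. cinner (T x) y = cinner x (S y))"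
      using adjoint_exists[OF assms] by blast
  next
    fix S S'
    assume "S \<in> bounded_ops \<and> (\<forall>x y. cinner (T x) y = cinner x (S y))"
      and "S' \<in> bounded_ops \<and> (\<forall>x y. cinner (T x) y = cinner x (S' y))"
    then show "S = S'"
      by (intro blinfun_eqI cinner_eqI) metis
  qed
  from theI'[OF this] show ?thesis
    unfolding adj_def by blast
qed

section \<open>Rank one operators\<close>

lemma rank_one_range:
  assumes "rank_one R"
  obtains y where "y \<noteq> 0" and "y \<in> range R" and "\<And>x. \<exists>a. R x = a *\<^sub>C y"
proof -
  obtain B where B: "B \<subseteq> range R" "complex_vector.independent B"
      "range R \<subseteq> complex_vector.span B" "card B = 1"
    using complex_vector.basis_exists[of "range R"] assms unfolding rank_one_def by metis
  then obtain y where y: "B = {y}"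
    by (auto simp: card_1_singleton_iff)
  show thesis
  proof (rule that[of y])
    show "y \<noteq> 0"
      using B(2) complex_vector.dependent_zero[of B] by (auto simp: y)
    show "y \<in> range R"
      using B(1) by (simp add: y)
    show "\<exists>a. R x = a *\<^sub>C y" for x
      using B(3) by (auto simp: y complex_vector.span_singleton)
  qed
qed

lemma rank_one_nonzero: "rank_one R \<Longrightarrow> R \<noteq> 0"
  using rank_one_range[of R] by (metis rangeE zero_blinfun.rep_eq)

text \<open>
  On the line containing the ranges of \<open>R\<close> and \<open>P = R T\<close>, the positive operator \<open>P P\<^sup>*\<close> is a scalar.
  The equation puts \<open>R\<close> into every ideal that contains \<open>R T\<close>, provided that the ambient algebra
  contains \<open>R\<close> and \<open>(R T)\<^sup>*\<close>.
\<close>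

lemma rank_one_recovery:
  fixes R T :: "'h::chilbert_space \<Rightarrow>\<^sub>L 'h"
  assumes R: "rank_one R" and P: "R o\<^sub>L T \<in> bounded_ops" and nz: "R o\<^sub>L T \<noteq> 0"
  shows "\<exists>c. c \<noteq> 0 \<and> R o\<^sub>L T o\<^sub>L adj (R o\<^sub>L T) o\<^sub>L R = c *\<^sub>C R"
proof -
  define P where "P = R o\<^sub>L T"
  obtain y where "y \<noteq> 0" and line: "\<And>x. \<exists>a. R x = a *\<^sub>C y"
    using rank_one_range[OF R] by metis
  have P_line: "\<exists>a. P x = a *\<^sub>C y" for x
    using line by (simp add: P_def)
  have adj: "cinner (P x) z = cinner x (adj P z)" for x z
    using cinner_adj P unfolding P_def by blast
  obtain c where c: "P (adj P y) = c *\<^sub>C y"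
    using P_line by blast
  have "c \<noteq> 0"
  proof
    assume "c = 0"
    then have "cinner (adj P y) (adj P y) = cinner 0 y"
      using adj[of "adj P y" y] by (simp add: c)
    also have "\<dots> = 0"
      using cinner_scaleC_left[of 0 0 y] by simp
    finally have "adj P y = 0"
      by (rule cinner_self_eq_zeroD)
    have "P x = 0" for x
    proof -
      obtain a where a: "P x = a *\<^sub>C y"
        using P_line by blast
      have "cinner (P x) (P x) = a * cinner x (adj P y)"
        by (subst (2) a) (simp add: cinner_scaleC_right adj)
      also have "\<dots> = 0"
        using cinner_scaleC_right[of x 0 0] by (simp add: \<open>adj P y = 0\<close>)
      finally show ?thesis
        by (rule cinner_self_eq_zeroD)
    qed
    with nz show False
      unfolding P_def by (metis blinfun_eqI zero_blinfun.rep_eq)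
  qed
  moreover have "P o\<^sub>L adj P o\<^sub>L R = c *\<^sub>C R"
  proof (rule blinfun_eqI)
    fix x
    obtain a where a: "R x = a *\<^sub>C y"
      using line by blast
    have "adj P (a *\<^sub>C y) = a *\<^sub>C adj P y"
      by (rule cinner_eqI) (simp add: cinner_scaleC_right flip: adj)
    moreover have "P (a *\<^sub>C z) = a *\<^sub>C P z" for z
      using P by (simp add: P_def bounded_ops_def)
    ultimately show "(P o\<^sub>L adj P o\<^sub>L R) x = (c *\<^sub>C R) x"
      by (simp add: a c scaleC_blinfun.rep_eq scaleC_scaleC mult.commute)
  qed
  ultimately show ?thesis
    unfolding P_def by blast
qed

section \<open>Reflexive hulls and generated algebras\<close>

lemma subset_reflexive_hull:
  assumes "\<R> \<subseteq> bounded_ops"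
  shows "\<R> \<subseteq> reflexive_hull \<R>"
  unfolding reflexive_hull_def
  using assms by (auto intro!: closure_subset[THEN subsetD] complex_vector.span_base)

text \<open>
  If all of \<open>\<R>\<close> kills a vector \<open>x\<close>, then \<open>[\<R>x]\<close> is zero, and the identity can only belong to the
  reflexive hull when \<open>x = 0\<close>.
\<close>

lemma unital_hull_separates:
  fixes \<R> :: "('h::chilbert_space \<Rightarrow>\<^sub>L 'h) set"
  assumes "unital (reflexive_hull \<R>)" and "\<And>R. R \<in> \<R> \<Longrightarrow> R x = 0"
  shows "x = 0"
proof -
  have "complex_vector.span ((\<lambda>R. blinfun_apply R x) ` \<R>) \<subseteq> complex_vector.span {0}"
    using assms(2) by (intro complex_vector.span_mono) auto
  also have "\<dots> = {0}"
    by (simp add: complex_vector.span_singleton)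
  finally have "closure (complex_vector.span ((\<lambda>R. blinfun_apply R x) ` \<R>)) \<subseteq> {0}"
    by (simp add: closure_minimal)
  then show ?thesis
    using assms(1) by (auto simp: unital_def reflexive_hull_def)
qed

lemma subset_cstar_generated: "U \<subseteq> cstar_generated U"
  by (auto simp: cstar_generated_def)

lemma adj_cstar_generated: "T \<in> cstar_generated U \<Longrightarrow> adj T \<in> cstar_generated U"
  by (auto simp: cstar_generated_def sa_subalgebra_def)

section \<open>The trivial intersection property\<close>

theorem corollary2p5:
  fixes D U :: "('h::chilbert_space \<Rightarrow>\<^sub>L 'h) set"
  assumes "masa D"
    and "strongly_reflexive U"
    and "unital U"
    and "bimodule D U"
  shows "trivial_intersection_property U"
  unfolding trivial_intersection_property_def
proof (intro allI impI)
  fix J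
  assume J: "closed_ideal J (cstar_generated U)" and triv: "U \<inter> J = {0}"
  have J_sub: "complex_vector.subspace J" "J \<subseteq> bounded_ops" "J \<subseteq> cstar_generated U"
    using J by (auto simp: closed_ideal_def operator_space_def)
  have left: "S o\<^sub>L T \<in> J" and right: "T o\<^sub>L S \<in> J"
    if "S \<in> cstar_generated U" "T \<in> J" for S T
    using J that by (auto simp: closed_ideal_def)
  obtain \<R> where rank: "\<And>R. R \<in> \<R> \<Longrightarrow> rank_one R" and U: "U = reflexive_hull \<R>"
    using assms(2) by (auto simp: strongly_reflexive_def)
  have \<R>_U: "\<R> \<subseteq> U"
    unfolding U by (rule subset_reflexive_hull) (use rank rank_one_def in blast)
  have "T = 0" if "T \<in> J" for T
  proof (rule ccontr)
    assume "T \<noteq> 0"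
    then obtain z where "T z \<noteq> 0"
      by (metis blinfun_eqI zero_blinfun.rep_eq)
    then obtain R where R: "R \<in> \<R>" "R (T z) \<noteq> 0"
      using unital_hull_separates assms(3) U by metis
    define P where "P = R o\<^sub>L T"
    have R_gen: "R \<in> cstar_generated U"
      using R(1) \<R>_U subset_cstar_generated by blast
    have "P \<in> J"
      unfolding P_def using R_gen that by (rule left)
    moreover have "P \<noteq> 0"
      using R(2) unfolding P_def by (metis blinfun_apply_blinfun_compose zero_blinfun.rep_eq)
    ultimately obtain c where c: "c \<noteq> 0" "P o\<^sub>L adj P o\<^sub>L R = c *\<^sub>C R"
      using rank_one_recovery[OF rank[OF R(1)], of T] J_sub(2) unfolding P_def by blast
    have "adj P \<in> cstar_generated U"
      using \<open>P \<in> J\<close> J_sub(3) adj_cstar_generated by blast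
    then have "c *\<^sub>C R \<in> J"
      using right[OF R_gen right[OF _ \<open>P \<in> J\<close>]] by (simp flip: c(2))
    then have "inverse c *\<^sub>C c *\<^sub>C R \<in> J"
      by (rule complex_vector.subspace_scale[OF J_sub(1)])
    then have "R \<in> J"
      using c(1) by (simp add: scaleC_scaleC)
    then have "R = 0"
      using triv R(1) \<R>_U by blast
    then show False
      using rank_one_nonzero rank[OF R(1)] by blast
  qed
  moreover have "0 \<in> J"
    using triv by blast
  ultimately show "J = {0}"
    by blast
qed

end
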